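(* Let $G$ be a group (finite or infinite) and let $n\geq 0$ be an integer. Let $W(G,n)\leq S(G^n)$ be the iterated (unrestricted) wreath product of $n$ copies of $G$, viewed as a permutation group on $G^n$. Then the normalizer of $W(G,n)$ in the symmetric group $S(G^n)$ is equal to an internal semidirect product $M_n\ltimes W(G,n)$ for some subgroup $M_n$ of $S(G^n)$ isomorphic to the direct power $\mathrm{Aut}(G)^n$. That is, $M_n\,W(G,n)=N_{S(G^n)}(W(G,n))$, $M_n\cap W(G,n)=1$, and $M_n\cong \mathrm{Aut}(G)^n$.
   Context: $S(Z)$ is the group of all permutations of a set $Z$. Permutations act on the right and products are composed from left to right: $z(fg)=(zf)g$. Unrestricted wreath product of permutation groups. Let $H\leq S(X)$ and $K\leq S(Y)$ be permutation groups on nonempty sets $X$ and $Y$, and let $Z=X\times Y$. For $x\in X$, $y\in Y$ write $x_y=(x,y)$ and $X_y=\{x_y\mid x\in X\}$. For $h\in H$, $y\in Y$ let $h_y\in S(X_y)$ be given by $x_yh_y=(xh)_y$ for all $x\in X$, and let $H_y=\{h_y\mid h\in H\}$. The base group $B$ is the group of all $f\in S(Z)$ such that, for every $y\in Y$, $X_yf=X_y$ and the restriction of $f$ to $X_y$ belongs to $H_y$. The group $K$ is embedded in $S(Z)$ by letting $k\in K$ act by $x_y\mapsto x_{yk}$. Then $K$ normalizes $B$ and $K\cap B=1$, and $H\wr K:=K\ltimes B\leq S(Z)$. Iterated wreath product. $G$ is viewed as a permutation group on itself by the regular representation (right multiplication). $W(G,0)$ is the trivial group acting on the one-point set $G^0$,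 and recursively $W(G,n+1)=W(G,n)\wr G$, a permutation group on $G^{n+1}=G^n\times G$ (here $X=G^n$, $H=W(G,n)$, $Y=K=G$). *)

theory Defs
  imports "HOL-Algebra.Bij" "HOL-Algebra.Group_Action" "HOL-Algebra.Product_Groups"
begin

(* The symmetric group S(Z) with permutations acting on the right: the product f g is
   "first f, then g", i.e. z(fg) = (zf)g.  BijGroup Z composes in the opposite order. *)
definition sym_grp :: "'z set \<Rightarrow> ('z \<Rightarrow> 'z) monoid" where
  "sym_grp Z = (BijGroup Z)\<lparr>mult := \<lambda>f g. g \<otimes>\<^bsub>BijGroup Z\<^esub> f\<rparr>"

(* The permutation h_y of X_y = X \<times> {y}. *)
definition fibre_perm :: "'x set \<Rightarrow> ('x \<Rightarrow> 'x) \<Rightarrow> 'y \<Rightarrow> ('x \<times> 'y \<Rightarrow> 'x \<times> 'y)" where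
  "fibre_perm X h y = (\<lambda>z\<in>X \<times> {y}. (h (fst z), snd z))"

definition base_group ::
  "'x set \<Rightarrow> ('x \<Rightarrow> 'x) set \<Rightarrow> 'y set \<Rightarrow> ('x \<times> 'y \<Rightarrow> 'x \<times> 'y) set" where
  "base_group X H Y =
     {f \<in> carrier (sym_grp (X \<times> Y)).
        \<forall>y\<in>Y. f ` (X \<times> {y}) = X \<times> {y} \<and>
              restrict f (X \<times> {y}) \<in> (\<lambda>h. fibre_perm X h y) ` H}"

(* The image of k \<in> S(Y) in S(X \<times> Y). *)
definition top_perm :: "'x set \<Rightarrow> 'y set \<Rightarrow> ('y \<Rightarrow> 'y) \<Rightarrow> ('x \<times> 'y \<Rightarrow> 'x \<times> 'y)" where
  "top_perm X Y k = (\<lambda>z\<in>X \<times> Y. (fst z, k (snd z)))"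

definition wreath ::
  "'x set \<Rightarrow> ('x \<Rightarrow> 'x) set \<Rightarrow> 'y set \<Rightarrow> ('y \<Rightarrow> 'y) set \<Rightarrow> ('x \<times> 'y \<Rightarrow> 'x \<times> 'y) set" where
  "wreath X H Y K = top_perm X Y ` K <#>\<^bsub>sym_grp (X \<times> Y)\<^esub> base_group X H Y"

definition right_regular :: "('a, 'b) monoid_scheme \<Rightarrow> ('a \<Rightarrow> 'a) set" where
  "right_regular G = (\<lambda>a. \<lambda>g\<in>carrier G. g \<otimes>\<^bsub>G\<^esub> a) ` carrier G"

(* All the sets G^n have to live in one type, so G^n is a set of lists of length n and
   (x, y) \<in> G^n \<times> G is identified with the list y # x, newest coordinate first. *)
definition cons_pair :: "'a list \<times> 'a \<Rightarrow> 'a list" where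
  "cons_pair z = snd z # fst z"

primrec tuples :: "('a, 'b) monoid_scheme \<Rightarrow> nat \<Rightarrow> 'a list set" where
  "tuples G 0 = {[]}"
| "tuples G (Suc n) = cons_pair ` (tuples G n \<times> carrier G)"

(* The permutation of e ` Z corresponding to f \<in> S(Z) under an injection e on Z. *)
definition transport_perm :: "('z \<Rightarrow> 'w) \<Rightarrow> 'z set \<Rightarrow> ('z \<Rightarrow> 'z) \<Rightarrow> ('w \<Rightarrow> 'w)" where
  "transport_perm e Z f = (\<lambda>w\<in>e ` Z. e (f (inv_into Z e w)))"

primrec iter_wreath :: "('a, 'b) monoid_scheme \<Rightarrow> nat \<Rightarrow> ('a list \<Rightarrow> 'a list) set" where
  "iter_wreath G 0 = {\<one>\<^bsub>sym_grp (tuples G 0)\<^esub>}"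
| "iter_wreath G (Suc n) =
     transport_perm cons_pair (tuples G n \<times> carrier G) `
       wreath (tuples G n) (iter_wreath G n) (carrier G) (right_regular G)"

end

theory Submission
  imports Defs "HOL-Algebra.Zassenhaus"
begin

text \<open>
  In the list encoding, the elements of \<open>W(G, n + 1)\<close> are the maps \<open>y # x \<mapsto> y a # x h\<^sub>y\<close> with
  \<open>a \<in> G\<close> and \<open>h\<^sub>y \<in> W(G, n)\<close>, and \<open>M\<^sub>n\<close> consists of the maps applying an automorphism of \<open>G\<close>
  to each coordinate.

  If \<open>G\<close> is nontrivial, two points agree in their first \<open>k\<close> coordinates if and only if every
  element of \<open>W(G, n)\<close> that fixes the first \<open>k + 1\<close> coordinates of the one also fixes those of the
  other. By downward induction on \<open>k\<close>, a permutation \<open>\<phi>\<close> normalizing \<open>W(G, n)\<close> therefore preserves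
  agreement in the first \<open>k\<close> coordinates for every \<open>k\<close>. For \<open>k = 1\<close> this gives
  \<open>\<phi> (y # x) = p y # F y x\<close>, where \<open>p\<close> normalizes the regular representation of \<open>G\<close>, so that \<open>p\<close> is
  an automorphism followed by a translation. Conjugating the elements that act within the fibres
  shows that \<open>F 1\<close> normalizes \<open>W(G, n - 1)\<close>, and conjugating the translations \<open>y # x \<mapsto> y a # x\<close>
  shows that every \<open>F a\<close> lies in the same \<open>W(G, n - 1)\<close>-coset as \<open>F 1\<close>. Induction on \<open>n\<close>
  concludes.
\<close>

section \<open>Wreath products in coordinates\<close>

lemma carrier_sym_grp [simp]: "carrier (sym_grp Z) = Bij Z"
  by (simp add: sym_grp_def BijGroup_def)

lemma one_sym_grp [simp]: "\<one>\<^bsub>sym_grp Z\<^esub> = (\<lambda>z\<in>Z. z)"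
  by (simp add: sym_grp_def BijGroup_def)

lemma mult_sym_grp [simp]:
  "f \<in> Bij Z \<Longrightarrow> g \<in> Bij Z \<Longrightarrow> f \<otimes>\<^bsub>sym_grp Z\<^esub> g = compose Z g f"
  by (simp add: sym_grp_def BijGroup_def)

lemma group_sym_grp: "group (sym_grp Z)"
proof (rule groupI)
  fix f assume f: "f \<in> carrier (sym_grp Z)"
  \<comment> \<open>A left inverse for the reversed product is a right inverse for ordinary
    composition.\<close>
  have "compose Z f (restrict (inv_into Z f) Z) = (\<lambda>z\<in>Z. z)"
    using f by (auto simp: Bij_def compose_def fun_eq_iff bij_betw_inv_into_right)
  with f show "\<exists>g\<in>carrier (sym_grp Z). g \<otimes>\<^bsub>sym_grp Z\<^esub> f = \<one>\<^bsub>sym_grp Z\<^esub>"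
    by (intro bexI[of _ "restrict (inv_into Z f) Z"]) (auto simp: restrict_inv_into_Bij)
next
  fix f assume "f \<in> carrier (sym_grp Z)"
  then show "\<one>\<^bsub>sym_grp Z\<^esub> \<otimes>\<^bsub>sym_grp Z\<^esub> f = f"
    using compose_Id[OF Bij_imp_funcset Bij_imp_extensional, of f Z] by (simp add: id_Bij)
qed (auto simp: compose_Bij id_Bij Bij_imp_funcset Bij_imp_extensional compose_assoc)

text \<open>Moving the inverse of \<open>g\<close> to the other side leaves relations between plain
  products, so that normalizing can later be tested by comparing permutations pointwise.\<close>

lemma (in group) mem_normalizer_iff:
  assumes "subgroup H G"
  shows "g \<in> normalizer G H \<longleftrightarrow> g \<in> carrier G \<and>
    (\<forall>h\<in>H. \<exists>h'\<in>H. g \<otimes> h = h' \<otimes> g) \<and> (\<forall>h'\<in>H. \<exists>h\<in>H. g \<otimes> h = h' \<otimes> g)"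
proof (cases "g \<in> carrier G")
  case True
  have H: "\<And>h. h \<in> H \<Longrightarrow> h \<in> carrier G"
    using assms subgroup.mem_carrier by metis
  have conj: "g \<otimes> h \<otimes> inv g = h' \<longleftrightarrow> g \<otimes> h = h' \<otimes> g" if "h \<in> H" "h' \<in> H" for h h'
    using that H True by (metis inv_solve_right m_closed)
  have "g <# H #> inv g = {g \<otimes> h \<otimes> inv g | h. h \<in> H}"
    by (auto simp: l_coset_def r_coset_def)
  then have "g \<in> normalizer G H \<longleftrightarrow> {g \<otimes> h \<otimes> inv g | h. h \<in> H} = H"
    using True H by (auto simp: normalizer_def stabilizer_def)
  also have "\<dots> \<longleftrightarrow> (\<forall>h\<in>H. \<exists>h'\<in>H. g \<otimes> h \<otimes> inv g = h') \<and> (\<forall>h'\<in>H. \<exists>h\<in>H. g \<otimes> h \<otimes> inv g = h')"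
    by (auto simp: set_eq_iff) metis+
  finally show ?thesis
    using True by (simp add: conj cong: bex_cong)
qed (auto simp: normalizer_def stabilizer_def)

lemma fibrewise_Bij:
  assumes "k \<in> Bij Y" "h \<in> Y \<rightarrow> Bij X"
  shows "(\<lambda>z\<in>X \<times> Y. (h (snd z) (fst z), k (snd z))) \<in> Bij (X \<times> Y)"
proof -
  have k: "inj_on k Y" "k ` Y = Y"
    using assms(1) by (auto simp: Bij_def bij_betw_def)
  have h: "h y ` X = X" "inj_on (h y) X" if "y \<in> Y" for y
    using assms(2) that by (auto simp: Bij_def bij_betw_def Pi_def)
  let ?f = "\<lambda>z\<in>X \<times> Y. (h (snd z) (fst z), k (snd z))"
  have "inj_on ?f (X \<times> Y)"
    using k(1) h(2) by (auto simp: inj_on_def)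
  moreover have "?f ` (X \<times> Y) = X \<times> Y"
  proof (intro equalityI subsetI)
    fix z assume "z \<in> ?f ` (X \<times> Y)"
    then obtain x y where "x \<in> X" "y \<in> Y" "z = (h y x, k y)" by auto
    with h(1) k(2) show "z \<in> X \<times> Y" by auto
  next
    fix z assume "z \<in> X \<times> Y"
    then obtain x y where z: "z = (x, y)" "x \<in> X" "y \<in> Y" by auto
    obtain y' where y': "y' \<in> Y" "y = k y'" using k(2) z(3) by blast
    obtain x' where "x' \<in> X" "x = h y' x'" using h(1)[OF y'(1)] z(2) by blast
    with y' z show "z \<in> ?f ` (X \<times> Y)"
      by (intro image_eqI[of _ _ "(x', y')"]) auto
  qed
  ultimately show ?thesis
    by (simp add: Bij_def bij_betw_def)
qed

text \<open>Membership is a separate condition on each fibre, so choosing one \<open>h y\<close> per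
  fibre gives a family. Every family occurs, because the product is unrestricted.\<close>

lemma base_group_eq:
  assumes "H \<subseteq> Bij X"
  shows "base_group X H Y = {\<lambda>z\<in>X \<times> Y. (h (snd z) (fst z), snd z) | h. h \<in> Y \<rightarrow> H}"
    (is "_ = ?R")
proof (intro equalityI subsetI)
  fix f assume f: "f \<in> base_group X H Y"
  then have "\<forall>y\<in>Y. \<exists>h\<in>H. restrict f (X \<times> {y}) = fibre_perm X h y"
    by (auto simp: base_group_def)
  then obtain h where h: "\<forall>y\<in>Y. h y \<in> H \<and> restrict f (X \<times> {y}) = fibre_perm X (h y) y"
    by metis
  have "f (x, y) = (h y x, y)" if "x \<in> X" "y \<in> Y" for x y
    using h[rule_format, OF that(2), THEN conjunct2, THEN fun_cong, of "(x, y)"] that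
    by (simp add: fibre_perm_def)
  moreover have "f \<in> extensional (X \<times> Y)"
    using f by (simp add: base_group_def Bij_imp_extensional)
  ultimately have "f = (\<lambda>z\<in>X \<times> Y. (h (snd z) (fst z), snd z))"
    by (intro extensionalityI[where A = "X \<times> Y"]) auto
  with h show "f \<in> ?R" by blast
next
  fix f assume "f \<in> ?R"
  then obtain h where h: "h \<in> Y \<rightarrow> H" "f = (\<lambda>z\<in>X \<times> Y. (h (snd z) (fst z), snd z))"
    by blast
  have "(\<lambda>z\<in>X \<times> Y. (h (snd z) (fst z), (\<lambda>y\<in>Y. y) (snd z))) \<in> Bij (X \<times> Y)"
    using h(1) assms by (intro fibrewise_Bij id_Bij) auto
  also have "(\<lambda>z\<in>X \<times> Y. (h (snd z) (fst z), (\<lambda>y\<in>Y. y) (snd z))) = f"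
    unfolding h(2) by auto
  finally have "f \<in> Bij (X \<times> Y)" .
  moreover have "f ` (X \<times> {y}) = X \<times> {y}" if "y \<in> Y" for y
  proof -
    have "h y \<in> Bij X"
      using assms h(1) that by auto
    then have "h y ` X = X"
      by (auto simp: Bij_def bij_betw_def)
    moreover have "f ` (X \<times> {y}) = (h y ` X) \<times> {y}"
      using that unfolding h(2) by force
    ultimately show ?thesis by simp
  qed
  moreover have "restrict f (X \<times> {y}) = fibre_perm X (h y) y" if "y \<in> Y" for y
    using that unfolding h(2) by (auto simp: fibre_perm_def)
  ultimately show "f \<in> base_group X H Y"
    using h(1) by (auto simp: base_group_def)
qed

text \<open>The base element acts after \<open>k\<close>, hence in the fibre over
  \<open>k y\<close>. Reindexing its family along the bijection \<open>k\<close> makes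
  \<open>h\<close> depend on the coordinate before the move.\<close>

lemma wreath_eq:
  assumes H: "H \<subseteq> Bij X" and K: "K \<subseteq> Bij Y"
  shows "wreath X H Y K =
    {\<lambda>z\<in>X \<times> Y. (h (snd z) (fst z), k (snd z)) | h k. h \<in> Y \<rightarrow> H \<and> k \<in> K}"
    (is "_ = ?R")
proof -
  have mult: "top_perm X Y k \<otimes>\<^bsub>sym_grp (X \<times> Y)\<^esub> (\<lambda>z\<in>X \<times> Y. (h (snd z) (fst z), snd z))
      = (\<lambda>z\<in>X \<times> Y. (h (k (snd z)) (fst z), k (snd z)))"
    if "k \<in> K" and h: "h \<in> Y \<rightarrow> H" for k h
  proof -
    have k: "k \<in> Bij Y" using K that by blast
    have "(\<lambda>z\<in>X \<times> Y. ((\<lambda>_. \<lambda>x\<in>X. x) (snd z) (fst z), k (snd z))) \<in> Bij (X \<times> Y)"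
      by (intro fibrewise_Bij k Pi_I id_Bij)
    also have "(\<lambda>z\<in>X \<times> Y. ((\<lambda>_. \<lambda>x\<in>X. x) (snd z) (fst z), k (snd z))) = top_perm X Y k"
      by (auto simp: top_perm_def)
    finally have top: "top_perm X Y k \<in> Bij (X \<times> Y)" .
    have "(\<lambda>z\<in>X \<times> Y. (h (snd z) (fst z), snd z)) \<in> base_group X H Y"
      using h base_group_eq[OF H] by blast
    then have "(\<lambda>z\<in>X \<times> Y. (h (snd z) (fst z), snd z)) \<in> Bij (X \<times> Y)"
      by (simp add: base_group_def)
    with top Bij_imp_funcset[OF k] show ?thesis
      by (auto simp: compose_def top_perm_def fun_eq_iff Pi_def)
  qed
  show ?thesis
  proof (intro equalityI subsetI)
    fix f assume "f \<in> wreath X H Y K"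
    then obtain h k where hk: "k \<in> K" "h \<in> Y \<rightarrow> H"
      "f = top_perm X Y k \<otimes>\<^bsub>sym_grp (X \<times> Y)\<^esub> (\<lambda>z\<in>X \<times> Y. (h (snd z) (fst z), snd z))"
      by (auto simp: wreath_def set_mult_def base_group_eq[OF H])
    moreover have "(\<lambda>y. h (k y)) \<in> Y \<rightarrow> H"
      using hk K Bij_imp_funcset by fast
    ultimately show "f \<in> ?R"
      by (auto simp: mult intro!: exI[of _ "\<lambda>y. h (k y)"] exI[of _ k])
  next
    fix f assume "f \<in> ?R"
    then obtain h k where hk: "h \<in> Y \<rightarrow> H" "k \<in> K"
      "f = (\<lambda>z\<in>X \<times> Y. (h (snd z) (fst z), k (snd z)))" by blast
    have k: "bij_betw k Y Y" using hk(2) K by (auto simp: Bij_def)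
    define h' where "h' = (\<lambda>y. h (inv_into Y k y))"
    have h': "h' \<in> Y \<rightarrow> H"
      using hk(1) k by (auto simp: h'_def bij_betw_def intro!: inv_into_into)
    have "f = (\<lambda>z\<in>X \<times> Y. (h' (k (snd z)) (fst z), k (snd z)))"
      using k by (auto simp: hk(3) h'_def bij_betw_inv_into_left)
    also have "\<dots> = top_perm X Y k \<otimes>\<^bsub>sym_grp (X \<times> Y)\<^esub> (\<lambda>z\<in>X \<times> Y. (h' (snd z) (fst z), snd z))"
      by (simp add: mult hk(2) h')
    finally show "f \<in> wreath X H Y K"
      using hk(2) h' by (auto simp: wreath_def set_mult_def base_group_eq[OF H])
  qed
qed

section \<open>Iterated wreath products on lists\<close>

text \<open>Common shape of both factors of the normalizer: right translations \<open>p\<close> with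
  all \<open>h y\<close> in \<open>iter_wreath G n\<close> give
  \<open>iter_wreath G (Suc n)\<close>, automorphisms \<open>p\<close> with a suitable constant
  \<open>h\<close> give \<open>diag_perm\<close>. The index of \<open>h\<close> is the head before
  \<open>p\<close> acts.\<close>

definition level_map ::
  "('a, 'b) monoid_scheme \<Rightarrow> nat \<Rightarrow> ('a \<Rightarrow> 'a) \<Rightarrow> ('a \<Rightarrow> 'a list \<Rightarrow> 'a list) \<Rightarrow> 'a list \<Rightarrow> 'a list" where
  "level_map G n p h = (\<lambda>z\<in>tuples G (Suc n). p (hd z) # h (hd z) (tl z))"

lemma Cons_tuples [simp]:
  "y # x \<in> tuples G (Suc n) \<longleftrightarrow> y \<in> carrier G \<and> x \<in> tuples G n"
  by (auto simp: cons_pair_def image_iff)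

lemma tuples_SucE:
  assumes "z \<in> tuples G (Suc n)"
  obtains y x where "z = y # x" "y \<in> carrier G" "x \<in> tuples G n"
  using assms by (auto simp: cons_pair_def)

lemma length_tuples: "z \<in> tuples G n \<Longrightarrow> length z = n"
  by (induction n arbitrary: z) (auto simp: cons_pair_def)

declare tuples.simps(2) [simp del]

lemma level_map_Cons [simp]:
  "y \<in> carrier G \<Longrightarrow> x \<in> tuples G n \<Longrightarrow> level_map G n p h (y # x) = p y # h y x"
  by (simp add: level_map_def)

lemma level_map_extensional [simp]: "level_map G n p h \<in> extensional (tuples G (Suc n))"
  by (simp add: level_map_def)

lemma level_map_eqI:
  assumes "f \<in> extensional (tuples G (Suc n))"
    and "\<And>y x. y \<in> carrier G \<Longrightarrow> x \<in> tuples G n \<Longrightarrow> f (y # x) = p y # h y x"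
  shows "f = level_map G n p h"
  using assms by (intro extensionalityI[OF assms(1)]) (auto elim!: tuples_SucE)

lemma level_map_Bij:
  assumes p: "bij_betw p (carrier G) (carrier G)" and h: "h \<in> carrier G \<rightarrow> Bij (tuples G n)"
  shows "level_map G n p h \<in> Bij (tuples G (Suc n))"
proof -
  have hy: "h y ` tuples G n = tuples G n" "inj_on (h y) (tuples G n)" if "y \<in> carrier G" for y
    using h that by (auto simp: Bij_def bij_betw_def Pi_def)
  have "inj_on (level_map G n p h) (tuples G (Suc n))"
    using p hy by (auto simp: inj_on_def bij_betw_def elim!: tuples_SucE)
  moreover have "level_map G n p h ` tuples G (Suc n) = tuples G (Suc n)"
  proof (intro equalityI subsetI)
    fix z assume "z \<in> level_map G n p h ` tuples G (Suc n)"
    then obtain y x where "y \<in> carrier G" "x \<in> tuples G n" "z = p y # h y x"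
      by (auto elim!: tuples_SucE)
    with hy p show "z \<in> tuples G (Suc n)"
      by (auto simp: bij_betw_def)
  next
    fix z assume "z \<in> tuples G (Suc n)"
    then obtain y x where z: "z = y # x" "y \<in> carrier G" "x \<in> tuples G n"
      by (auto elim!: tuples_SucE)
    obtain y' where y': "y' \<in> carrier G" "y = p y'"
      using z(2) p by (metis bij_betw_def imageE)
    obtain x' where "x' \<in> tuples G n" "x = h y' x'"
      using hy(1)[OF y'(1)] z(3) by blast
    with z y' show "z \<in> level_map G n p h ` tuples G (Suc n)"
      by (intro image_eqI[of _ _ "y' # x'"]) auto
  qed
  ultimately show ?thesis
    by (simp add: Bij_def bij_betw_def)
qed

context group
begin

lemma bij_betw_rmult: "a \<in> carrier G \<Longrightarrow> bij_betw (\<lambda>y. y \<otimes> a) (carrier G) (carrier G)"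
  by (rule bij_betw_byWitness[where f' = "\<lambda>y. y \<otimes> inv a"]) (auto simp: m_assoc)

lemma right_regular_Bij: "right_regular G \<subseteq> Bij (carrier G)"
  using bij_betw_rmult by (auto simp: right_regular_def Bij_def cong: bij_betw_cong)

text \<open>Inclusion in \<open>Bij\<close> is assumed because its own inductive proof rests on this
  description; \<open>iter_wreath_Suc\<close> then discharges it.\<close>

lemma iter_wreath_Suc_aux:
  assumes "iter_wreath G n \<subseteq> Bij (tuples G n)"
  shows "iter_wreath G (Suc n) =
    {level_map G n (\<lambda>y. y \<otimes> a) h | a h. a \<in> carrier G \<and> h \<in> carrier G \<rightarrow> iter_wreath G n}"
proof -
  let ?Z = "tuples G n \<times> carrier G"
  let ?f = "\<lambda>h k. \<lambda>z\<in>?Z. (h (snd z) (fst z), k (snd z))"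
  have inj: "inj_on cons_pair ?Z"
    by (auto simp: inj_on_def cons_pair_def)
  have tr: "transport_perm cons_pair ?Z (?f h (\<lambda>g\<in>carrier G. g \<otimes> a)) = level_map G n (\<lambda>y. y \<otimes> a) h"
    for h a
  proof (rule level_map_eqI)
    fix y x assume yx: "y \<in> carrier G" "x \<in> tuples G n"
    then have "inv_into ?Z cons_pair (y # x) = (x, y)"
      using inv_into_f_f[OF inj, of "(x, y)"] by (simp add: cons_pair_def)
    moreover have "y # x \<in> cons_pair ` ?Z"
      using yx by (force simp: cons_pair_def)
    ultimately show "transport_perm cons_pair ?Z (?f h (\<lambda>g\<in>carrier G. g \<otimes> a)) (y # x) = (y \<otimes> a) # h y x"
      using yx by (simp add: transport_perm_def) (simp add: cons_pair_def)
  qed (simp add: transport_perm_def tuples.simps)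
  have "iter_wreath G (Suc n) =
      transport_perm cons_pair ?Z ` {?f h k | h k. h \<in> carrier G \<rightarrow> iter_wreath G n \<and> k \<in> right_regular G}"
    using wreath_eq[OF assms right_regular_Bij] by simp
  also have "\<dots> = {transport_perm cons_pair ?Z (?f h (\<lambda>g\<in>carrier G. g \<otimes> a)) | a h.
      a \<in> carrier G \<and> h \<in> carrier G \<rightarrow> iter_wreath G n}"
    unfolding right_regular_def by blast
  finally show ?thesis
    unfolding tr .
qed

lemma iter_wreath_Bij: "iter_wreath G n \<subseteq> Bij (tuples G n)"
proof (induction n)
  case 0
  show ?case using id_Bij[of "{[]}"] by simp
next
  case (Suc n)
  then show ?case
    by (auto simp: iter_wreath_Suc_aux[OF Suc] simp del: iter_wreath.simps
        intro!: level_map_Bij bij_betw_rmult)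
qed

lemmas iter_wreath_Suc = iter_wreath_Suc_aux[OF iter_wreath_Bij]

end

declare iter_wreath.simps(2) [simp del]

text \<open>Automorphisms are numbered by the level that adds their coordinate:
  \<open>\<sigma> 0\<close> acts on the last entry and the highest index on the head. Going up one
  level keeps all earlier indices.\<close>

primrec diag_perm ::
  "('a, 'b) monoid_scheme \<Rightarrow> nat \<Rightarrow> (nat \<Rightarrow> 'a \<Rightarrow> 'a) \<Rightarrow> 'a list \<Rightarrow> 'a list" where
  "diag_perm G 0 \<sigma> = (\<lambda>z\<in>{[]}. z)"
| "diag_perm G (Suc n) \<sigma> = level_map G n (\<sigma> n) (\<lambda>_. diag_perm G n \<sigma>)"

lemma diag_perm_cong:
  assumes "\<And>i g. i < n \<Longrightarrow> g \<in> carrier G \<Longrightarrow> \<sigma> i g = \<tau> i g"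
  shows "diag_perm G n \<sigma> = diag_perm G n \<tau>"
  using assms
proof (induction n)
  case (Suc n)
  then have "diag_perm G n \<sigma> = diag_perm G n \<tau>" by simp
  with Suc.prems show ?case by (auto intro!: level_map_eqI)
qed simp

text \<open>Pointwise form of membership in the normalizer. The quantified clauses are the two
  inclusions between the group and its conjugate; in infinite groups one inclusion need not give the
  other.\<close>

definition normalizing_perm :: "('a, 'b) monoid_scheme \<Rightarrow> nat \<Rightarrow> ('a list \<Rightarrow> 'a list) \<Rightarrow> bool" where
  "normalizing_perm G n \<phi> \<longleftrightarrow> \<phi> \<in> Bij (tuples G n) \<and>
    (\<forall>w\<in>iter_wreath G n. \<exists>w'\<in>iter_wreath G n. \<forall>z\<in>tuples G n. \<phi> (w z) = w' (\<phi> z)) \<and>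
    (\<forall>w'\<in>iter_wreath G n. \<exists>w\<in>iter_wreath G n. \<forall>z\<in>tuples G n. \<phi> (w z) = w' (\<phi> z))"

section \<open>Group laws and the normalizer of \<open>iter_wreath\<close>\<close>

context group
begin

lemma iter_wreath_SucI:
  "a \<in> carrier G \<Longrightarrow> h \<in> carrier G \<rightarrow> iter_wreath G n \<Longrightarrow>
    level_map G n (\<lambda>y. y \<otimes> a) h \<in> iter_wreath G (Suc n)"
  by (auto simp: iter_wreath_Suc)

lemma iter_wreath_SucE:
  assumes "w \<in> iter_wreath G (Suc n)"
  obtains a h where "a \<in> carrier G" "\<forall>y\<in>carrier G. h y \<in> iter_wreath G n"
    "w = level_map G n (\<lambda>y. y \<otimes> a) h"
  using assms by (auto simp: iter_wreath_Suc Pi_def)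

lemma iter_wreath_in_tuples: "w \<in> iter_wreath G n \<Longrightarrow> z \<in> tuples G n \<Longrightarrow> w z \<in> tuples G n"
  using iter_wreath_Bij Bij_imp_funcset by fast

lemma tuples_nonempty: "replicate n \<one> \<in> tuples G n"
  by (induction n) auto

lemma id_iter_wreath: "(\<lambda>z\<in>tuples G n. z) \<in> iter_wreath G n"
proof (induction n)
  case (Suc n)
  have "(\<lambda>z\<in>tuples G (Suc n). z) = level_map G n (\<lambda>y. y \<otimes> \<one>) (\<lambda>_. \<lambda>z\<in>tuples G n. z)"
    by (rule level_map_eqI) auto
  with Suc show ?case
    by (auto intro: iter_wreath_SucI simp del: restrict_apply)
qed (simp del: restrict_apply)

lemma compose_iter_wreath:
  "f \<in> iter_wreath G n \<Longrightarrow> g \<in> iter_wreath G n \<Longrightarrow> compose (tuples G n) g f \<in> iter_wreath G n"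
proof (induction n arbitrary: f g)
  case 0
  then show ?case by (auto simp: compose_def cong: restrict_cong)
next
  case (Suc n)
  obtain a h where f: "a \<in> carrier G" "\<forall>y\<in>carrier G. h y \<in> iter_wreath G n"
    "f = level_map G n (\<lambda>y. y \<otimes> a) h" using Suc.prems(1) by (rule iter_wreath_SucE)
  obtain b k where g: "b \<in> carrier G" "\<forall>y\<in>carrier G. k y \<in> iter_wreath G n"
    "g = level_map G n (\<lambda>y. y \<otimes> b) k" using Suc.prems(2) by (rule iter_wreath_SucE)
  \<comment> \<open>\<open>f\<close> acts first and moves the head to \<open>y \<otimes> a\<close>,
    which is therefore the index of the component of \<open>g\<close>.\<close>
  have "compose (tuples G (Suc n)) g f =
      level_map G n (\<lambda>y. y \<otimes> (a \<otimes> b)) (\<lambda>y. compose (tuples G n) (k (y \<otimes> a)) (h y))"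
    using f g by (intro level_map_eqI) (auto simp: compose_def m_assoc iter_wreath_in_tuples)
  with f g Suc.IH show ?case
    by (auto intro!: iter_wreath_SucI)
qed

lemma iter_wreath_inverse:
  "w \<in> iter_wreath G n \<Longrightarrow> \<exists>w'\<in>iter_wreath G n. \<forall>z\<in>tuples G n. w' (w z) = z"
proof (induction n arbitrary: w)
  case (Suc n)
  obtain a h where w: "a \<in> carrier G" "\<forall>y\<in>carrier G. h y \<in> iter_wreath G n"
    "w = level_map G n (\<lambda>y. y \<otimes> a) h" using Suc.prems by (rule iter_wreath_SucE)
  have "\<forall>y\<in>carrier G. \<exists>w'\<in>iter_wreath G n. \<forall>z\<in>tuples G n. w' (h y z) = z"
    using Suc.IH w(2) by blast
  then obtain k where k: "\<forall>y\<in>carrier G. k y \<in> iter_wreath G n \<and> (\<forall>z\<in>tuples G n. k y (h y z) = z)"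
    by metis
  \<comment> \<open>The inverse meets the head after multiplication by \<open>a\<close>, so its
    family looks up the original head.\<close>
  let ?w' = "level_map G n (\<lambda>y. y \<otimes> inv a) (\<lambda>y. k (y \<otimes> inv a))"
  have "?w' \<in> iter_wreath G (Suc n)"
    using w(1) k by (intro iter_wreath_SucI) auto
  moreover have "\<forall>z\<in>tuples G (Suc n). ?w' (w z) = z"
    using w k by (auto elim!: tuples_SucE simp: iter_wreath_in_tuples m_assoc)
  ultimately show ?case by blast
qed auto

lemma subgroup_iter_wreath: "subgroup (iter_wreath G n) (sym_grp (tuples G n))"
proof -
  interpret S: group "sym_grp (tuples G n)" by (rule group_sym_grp)
  have B: "w \<in> Bij (tuples G n)" if "w \<in> iter_wreath G n" for w
    using that iter_wreath_Bij by blast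
  show ?thesis
  proof (rule S.subgroupI)
    fix w assume w: "w \<in> iter_wreath G n"
    then obtain w' where w': "w' \<in> iter_wreath G n" "\<forall>z\<in>tuples G n. w' (w z) = z"
      using iter_wreath_inverse by blast
    have "w \<otimes>\<^bsub>sym_grp (tuples G n)\<^esub> w' = \<one>\<^bsub>sym_grp (tuples G n)\<^esub>"
      using w w' B by (auto simp: compose_def)
    then have "inv\<^bsub>sym_grp (tuples G n)\<^esub> w' = w"
      using B w w'(1) by (intro S.inv_equality) auto
    then have "inv\<^bsub>sym_grp (tuples G n)\<^esub> w = w'"
      using B w'(1) S.inv_inv[of w'] by simp
    with w'(1) show "inv\<^bsub>sym_grp (tuples G n)\<^esub> w \<in> iter_wreath G n" by simp
  qed (use B id_iter_wreath in \<open>auto simp: compose_iter_wreath\<close>)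
qed

lemma mem_normalizer_iter_wreath:
  "\<phi> \<in> normalizer (sym_grp (tuples G n)) (iter_wreath G n) \<longleftrightarrow> normalizing_perm G n \<phi>"
proof (cases "\<phi> \<in> Bij (tuples G n)")
  case True
  \<comment> \<open>Products act from left to right, so \<open>w'\<close> takes the role of
    \<open>h\<close> in \<open>mem_normalizer_iff\<close> and \<open>w\<close> that of
    \<open>h'\<close>: the two clauses trade places.\<close>
  have eq: "\<phi> \<otimes>\<^bsub>sym_grp (tuples G n)\<^esub> w' = w \<otimes>\<^bsub>sym_grp (tuples G n)\<^esub> \<phi> \<longleftrightarrow>
      (\<forall>z\<in>tuples G n. \<phi> (w z) = w' (\<phi> z))"
    if "w \<in> iter_wreath G n" "w' \<in> iter_wreath G n" for w w'
  proof -
    have "w \<in> Bij (tuples G n)" "w' \<in> Bij (tuples G n)"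
      using that iter_wreath_Bij by blast+
    with True show ?thesis
      by (auto simp: compose_def fun_eq_iff restrict_def)
  qed
  show ?thesis
    unfolding group.mem_normalizer_iff[OF group_sym_grp subgroup_iter_wreath] normalizing_perm_def
    using True by (auto simp: eq cong: bex_cong)
qed (auto simp: normalizing_perm_def group.mem_normalizer_iff[OF group_sym_grp subgroup_iter_wreath])

section \<open>The normalizer preserves common prefixes\<close>

text \<open>The head alone determines both its image and the map applied to the tail. Hence the
  group acts on the rooted tree of prefixes.\<close>

lemma take_iter_wreath:
  assumes "w \<in> iter_wreath G n" "z \<in> tuples G n" "z' \<in> tuples G n" "take k z = take k z'"
  shows "take k (w z) = take k (w z')"
  using assms
proof (induction n arbitrary: k w z z')
  case (Suc n)
  obtain a h where w: "a \<in> carrier G" "\<forall>y\<in>carrier G. h y \<in> iter_wreath G n"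
    "w = level_map G n (\<lambda>y. y \<otimes> a) h" using Suc.prems(1) by (rule iter_wreath_SucE)
  show ?case
  proof (cases k)
    case (Suc j)
    obtain y x where z: "z = y # x" "y \<in> carrier G" "x \<in> tuples G n"
      using Suc.prems(2) by (rule tuples_SucE)
    obtain x' where z': "z' = y # x'" "x' \<in> tuples G n" "take j x = take j x'"
      using Suc.prems(3,4) z Suc by (auto elim!: tuples_SucE)
    have "take j (h y x) = take j (h y x')"
      using w(2) z z' by (intro Suc.IH[of "h y"]) auto
    with w z z' Suc show ?thesis by simp
  qed simp
qed simp

text \<open>Below a common prefix of length \<open>k\<close>, the next coordinate undergoes one and
  the same right translation in both points. The regular representation is free, so a translation
  fixing one coordinate is trivial.\<close>

lemma stabilizer_take:
  assumes "w \<in> iter_wreath G n" "z \<in> tuples G n" "z' \<in> tuples G n" "take k z = take k z'"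
    and "take (Suc k) (w z) = take (Suc k) z"
  shows "take (Suc k) (w z') = take (Suc k) z'"
  using assms
proof (induction n arbitrary: k w z z')
  case (Suc n)
  obtain a h where w: "a \<in> carrier G" "\<forall>y\<in>carrier G. h y \<in> iter_wreath G n"
    "w = level_map G n (\<lambda>y. y \<otimes> a) h" using Suc.prems(1) by (rule iter_wreath_SucE)
  obtain y x where z: "z = y # x" "y \<in> carrier G" "x \<in> tuples G n"
    using Suc.prems(2) by (rule tuples_SucE)
  obtain y' x' where z': "z' = y' # x'" "y' \<in> carrier G" "x' \<in> tuples G n"
    using Suc.prems(3) by (rule tuples_SucE)
  have "y \<otimes> a = y" using Suc.prems(5) w z by simp
  then have a: "a = \<one>" using w(1) z(2) by simp
  show ?case
  proof (cases k)
    case 0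
    then show ?thesis using a w z' by simp
  next
    case (Suc j)
    then have y: "y' = y" "take j x = take j x'" and "take (Suc j) (h y x) = take (Suc j) x"
      using Suc.prems(4,5) w z z' by auto
    then have "take (Suc j) (h y x') = take (Suc j) x'"
      using Suc.IH[OF w(2)[rule_format, OF z(2)] z(3) z'(3)] by blast
    then show ?thesis
      using a w z' y Suc by simp
  qed
qed auto

text \<open>Suppose \<open>k\<close> is positive and the heads differ. Fixing all heads and
  translating the next coordinate by \<open>a\<close> only in the fibre of \<open>z'\<close> fixes
  \<open>z\<close> but moves \<open>z'\<close> within the first \<open>Suc k\<close> coordinates, a
  contradiction. Equal heads reduce the claim to the tails.\<close>

lemma take_eq_if_stabilizer:
  assumes "a \<in> carrier G" "a \<noteq> \<one>" "z \<in> tuples G n" "z' \<in> tuples G n" "k < n"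
    and "\<And>w. w \<in> iter_wreath G n \<Longrightarrow> take (Suc k) (w z) = take (Suc k) z \<Longrightarrow>
      take (Suc k) (w z') = take (Suc k) z'"
  shows "take k z = take k z'"
  using assms(3-)
proof (induction n arbitrary: k z z')
  case (Suc n)
  obtain y x where z: "z = y # x" "y \<in> carrier G" "x \<in> tuples G n"
    using Suc.prems(1) by (rule tuples_SucE)
  obtain y' x' where z': "z' = y' # x'" "y' \<in> carrier G" "x' \<in> tuples G n"
    using Suc.prems(2) by (rule tuples_SucE)
  show ?case
  proof (cases k)
    \<comment> \<open>The bound on \<open>k\<close> makes the tails nonempty, so that they have a
      head to translate.\<close>
    case (Suc j)
    with Suc.prems(3) obtain m where m: "n = Suc m" "j < n"
      using less_imp_Suc_add by auto
    \<comment> \<open>The family \<open>h\<close> is arbitrary: it may act differently over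
      \<open>y\<close> and \<open>y'\<close>, or be constant when the tails are compared.\<close>
    have stab: "take (Suc j) (h y' x') = take (Suc j) x'"
      if "\<And>v. v \<in> carrier G \<Longrightarrow> h v \<in> iter_wreath G n" "take (Suc j) (h y x) = take (Suc j) x" for h
    proof -
      have "level_map G n (\<lambda>y. y \<otimes> \<one>) h \<in> iter_wreath G (Suc n)"
        using that by (intro iter_wreath_SucI) auto
      from Suc.prems(4)[OF this] show ?thesis
        using that z z' Suc by simp
    qed
    have "y = y'"
    proof (rule ccontr)
      assume "y \<noteq> y'"
      define t where "t = level_map G m (\<lambda>y. y \<otimes> a) (\<lambda>_. \<lambda>x\<in>tuples G m. x)"
      have t: "t \<in> iter_wreath G n"
        unfolding m(1) t_def using id_iter_wreath assms(1) by (intro iter_wreath_SucI Pi_I)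
      define h where "h v = (if v = y' then t else (\<lambda>x\<in>tuples G n. x))" for v
      have "take (Suc j) (h y' x') = take (Suc j) x'"
        using t id_iter_wreath z(3) \<open>y \<noteq> y'\<close> by (intro stab) (auto simp: h_def)
      then have "take (Suc j) (t x') = take (Suc j) x'"
        by (simp add: h_def)
      moreover obtain u x'' where "x' = u # x''" "u \<in> carrier G" "x'' \<in> tuples G m"
        using z'(3) unfolding m(1) by (rule tuples_SucE)
      ultimately show False
        using assms(1,2) by (simp add: t_def)
    qed
    moreover have "take j x = take j x'"
    proof (rule Suc.IH[OF z(3) z'(3) m(2)])
      fix w assume "w \<in> iter_wreath G n" "take (Suc j) (w x) = take (Suc j) x"
      then show "take (Suc j) (w x') = take (Suc j) x'"
        using stab[of "\<lambda>_. w"] by simp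
    qed
    ultimately show ?thesis using z z' Suc by simp
  qed simp
qed simp

lemma normalizing_perm_in_tuples:
  "normalizing_perm G n \<phi> \<Longrightarrow> z \<in> tuples G n \<Longrightarrow> \<phi> z \<in> tuples G n"
  unfolding normalizing_perm_def using Bij_imp_funcset by fast

lemma normalizing_perm_take:
  assumes a: "a \<in> carrier G" "a \<noteq> \<one>" and \<phi>: "normalizing_perm G n \<phi>" and "k \<le> n"
  shows "\<forall>z\<in>tuples G n. \<forall>z'\<in>tuples G n. take k (\<phi> z) = take k (\<phi> z') \<longleftrightarrow> take k z = take k z'"
  using \<open>k \<le> n\<close>
proof (induction rule: inc_induct)
  case base
  \<comment> \<open>A prefix of length \<open>n\<close> is the whole list, so the top case is
    injectivity.\<close>
  have "inj_on \<phi> (tuples G n)"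
    using \<phi> by (auto simp: normalizing_perm_def Bij_def bij_betw_def)
  then show ?case
    using length_tuples[OF normalizing_perm_in_tuples[OF \<phi>]] by (auto simp: length_tuples inj_on_def)
next
  case (step k)
  show ?case
  proof (intro ballI)
    fix z z' assume z: "z \<in> tuples G n" "z' \<in> tuples G n"
    \<comment> \<open>Agreement in \<open>k\<close> coordinates is expressed through prefixes of
      length \<open>Suc k\<close> and the group action. The induction hypothesis carries the former
      along \<open>\<phi>\<close>, the normalizing relation the latter.\<close>
    have take_eq: "take k x = take k y \<longleftrightarrow> (\<forall>w\<in>iter_wreath G n.
        take (Suc k) (w x) = take (Suc k) x \<longrightarrow> take (Suc k) (w y) = take (Suc k) y)"
      if "x \<in> tuples G n" "y \<in> tuples G n" for x y
      using that stabilizer_take take_eq_if_stabilizer[OF a _ _ step.hyps(2)] by metis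
    have "take k z = take k z' \<longleftrightarrow> (\<forall>w\<in>iter_wreath G n.
        take (Suc k) (\<phi> (w z)) = take (Suc k) (\<phi> z) \<longrightarrow> take (Suc k) (\<phi> (w z')) = take (Suc k) (\<phi> z'))"
      using z step.IH by (simp add: take_eq iter_wreath_in_tuples)
    \<comment> \<open>Each \<open>w\<close> is exchanged with its conjugate; the two clauses of
      \<open>normalizing_perm\<close> give the two directions.\<close>
    also have "\<dots> \<longleftrightarrow> (\<forall>w\<in>iter_wreath G n.
        take (Suc k) (w (\<phi> z)) = take (Suc k) (\<phi> z) \<longrightarrow> take (Suc k) (w (\<phi> z')) = take (Suc k) (\<phi> z'))"
      using \<phi> z unfolding normalizing_perm_def by metis
    also have "\<dots> \<longleftrightarrow> take k (\<phi> z) = take k (\<phi> z')"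
      using z by (intro take_eq[symmetric] normalizing_perm_in_tuples[OF \<phi>])
    finally show "take k (\<phi> z) = take k (\<phi> z') \<longleftrightarrow> take k z = take k z'" ..
  qed
qed

lemma normalizing_perm_hd:
  assumes \<phi>: "normalizing_perm G (Suc n) \<phi>"
    and z: "z \<in> tuples G (Suc n)" "z' \<in> tuples G (Suc n)"
  shows "hd (\<phi> z) = hd (\<phi> z') \<longleftrightarrow> hd z = hd z'"
proof (cases "\<exists>a\<in>carrier G. a \<noteq> \<one>")
  case True
  then obtain a where a: "a \<in> carrier G" "a \<noteq> \<one>" by blast
  have "take (Suc 0) x = take (Suc 0) y \<longleftrightarrow> hd x = hd y"
    if "x \<in> tuples G (Suc n)" "y \<in> tuples G (Suc n)" for x y
    using that by (auto elim!: tuples_SucE)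
  then show ?thesis
    using normalizing_perm_take[OF a \<phi>, of "Suc 0"] z normalizing_perm_in_tuples[OF \<phi>] by simp
next
  \<comment> \<open>A trivial \<open>G\<close> offers no translation to separate points, but then
    there is only one possible head.\<close>
  case False
  then have "hd x = \<one>" if "x \<in> tuples G (Suc n)" for x
    using that by (auto elim!: tuples_SucE)
  then show ?thesis
    using z normalizing_perm_in_tuples[OF \<phi>] by simp
qed

section \<open>Coordinatewise automorphisms\<close>

lemma diag_perm_Bij:
  "\<sigma> \<in> {..<n} \<rightarrow> auto G \<Longrightarrow> diag_perm G n \<sigma> \<in> Bij (tuples G n)"
proof (induction n)
  case 0
  show ?case unfolding diag_perm.simps tuples.simps by (rule id_Bij)
next
  case (Suc n)
  have "\<sigma> n \<in> auto G" using Suc.prems by auto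
  then have "bij_betw (\<sigma> n) (carrier G) (carrier G)"
    by (auto simp: auto_def Bij_def)
  moreover have "diag_perm G n \<sigma> \<in> Bij (tuples G n)"
    using Suc.prems by (intro Suc.IH) auto
  ultimately show ?case
    by (auto intro!: level_map_Bij)
qed

lemma diag_perm_compose:
  assumes "\<sigma> \<in> {..<n} \<rightarrow> auto G" "\<tau> \<in> {..<n} \<rightarrow> auto G"
  shows "diag_perm G n (\<lambda>i. compose (carrier G) (\<sigma> i) (\<tau> i)) =
    compose (tuples G n) (diag_perm G n \<sigma>) (diag_perm G n \<tau>)"
  using assms
proof (induction n)
  case 0
  show ?case by (auto simp: compose_def)
next
  case (Suc n)
  have \<tau>: "\<tau> n \<in> carrier G \<rightarrow> carrier G"
    using Suc.prems by (auto simp: auto_def Pi_def dest: Bij_imp_funcset)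
  have d: "diag_perm G n \<tau> x \<in> tuples G n" if "x \<in> tuples G n" for x
    using diag_perm_Bij[of \<tau> n] Suc.prems(2) Bij_imp_funcset that by fastforce
  have IH: "diag_perm G n (\<lambda>i. compose (carrier G) (\<sigma> i) (\<tau> i)) =
      compose (tuples G n) (diag_perm G n \<sigma>) (diag_perm G n \<tau>)"
    using Suc.prems by (intro Suc.IH) auto
  have "compose (tuples G (Suc n)) (diag_perm G (Suc n) \<sigma>) (diag_perm G (Suc n) \<tau>) =
      diag_perm G (Suc n) (\<lambda>i. compose (carrier G) (\<sigma> i) (\<tau> i))"
    unfolding diag_perm.simps IH using \<tau> d
    by (intro level_map_eqI) (auto simp: compose_def Pi_def)
  then show ?case ..
qed

text \<open>Each coordinate can be tested alone, since the others can be filled with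
  \<open>\<one>\<close>. This yields injectivity of the embedding of the direct power.\<close>

lemma diag_perm_eqD:
  assumes "diag_perm G n \<sigma> = diag_perm G n \<tau>" "i < n" "g \<in> carrier G"
  shows "\<sigma> i g = \<tau> i g"
  using assms
proof (induction n)
  case (Suc n)
  have eq: "\<sigma> n y = \<tau> n y \<and> diag_perm G n \<sigma> x = diag_perm G n \<tau> x"
    if "y \<in> carrier G" "x \<in> tuples G n" for y x
    using that fun_cong[OF Suc.prems(1), of "y # x"] by simp
  have ext: "diag_perm G n \<rho> \<in> extensional (tuples G n)" for \<rho>
    by (cases n) auto
  show ?case
  proof (cases "i = n")
    case True
    then show ?thesis using eq tuples_nonempty Suc.prems(3) by blast
  next
    case False
    have "diag_perm G n \<sigma> = diag_perm G n \<tau>"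
      using ext eq[OF one_closed] by (intro extensionalityI[of _ "tuples G n"]) auto
    with False Suc show ?thesis by simp
  qed
qed simp

text \<open>An automorphism turns translation by \<open>a\<close> into translation by
  \<open>\<sigma> n a\<close>, while the lower diagonal permutation normalizes the group acting in
  the fibres.\<close>

lemma diag_perm_normalizing:
  "\<sigma> \<in> {..<n} \<rightarrow> auto G \<Longrightarrow> normalizing_perm G n (diag_perm G n \<sigma>)"
proof (induction n)
  case 0
  show ?case
    using diag_perm_Bij[of \<sigma> 0] unfolding normalizing_perm_def by auto
next
  case (Suc n)
  let ?d = "diag_perm G n \<sigma>"
  have IH: "normalizing_perm G n ?d" using Suc.prems by (intro Suc.IH) auto
  have "\<sigma> n \<in> auto G" using Suc.prems by auto
  then have hom: "\<sigma> n \<in> hom G G" and bij: "bij_betw (\<sigma> n) (carrier G) (carrier G)"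
    by (auto simp: auto_def Bij_def)
  define q where "q = inv_into (carrier G) (\<sigma> n)"
  have q: "q y \<in> carrier G" "\<sigma> n (q y) = y" if "y \<in> carrier G" for y
    using bij that by (auto simp: q_def bij_betw_inv_into_right intro: bij_betw_apply[OF bij_betw_inv_into])
  have q': "q (\<sigma> n y) = y" "\<sigma> n y \<in> carrier G" if "y \<in> carrier G" for y
    using bij that by (auto simp: q_def bij_betw_inv_into_left intro: bij_betw_apply)
  have d: "?d x \<in> tuples G n" if "x \<in> tuples G n" for x
    using normalizing_perm_in_tuples[OF IH that] .
  have "\<exists>w'\<in>iter_wreath G (Suc n). \<forall>z\<in>tuples G (Suc n).
      diag_perm G (Suc n) \<sigma> (w z) = w' (diag_perm G (Suc n) \<sigma> z)"
    if mem: "w \<in> iter_wreath G (Suc n)" for w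
  proof -
    obtain a h where w: "a \<in> carrier G" "\<forall>y\<in>carrier G. h y \<in> iter_wreath G n"
      "w = level_map G n (\<lambda>y. y \<otimes> a) h" using mem by (rule iter_wreath_SucE)
    have "\<forall>y\<in>carrier G. \<exists>w'\<in>iter_wreath G n. \<forall>x\<in>tuples G n. ?d (h y x) = w' (?d x)"
      using IH w(2) by (simp add: normalizing_perm_def)
    then obtain k where k: "\<forall>y\<in>carrier G. k y \<in> iter_wreath G n \<and> (\<forall>x\<in>tuples G n. ?d (h y x) = k y (?d x))"
      by metis
    \<comment> \<open>The conjugate meets heads already moved by \<open>\<sigma> n\<close>;
      \<open>q\<close> recovers the original head that indexes \<open>k\<close>.\<close>
    show ?thesis
    proof (intro bexI[of _ "level_map G n (\<lambda>y. y \<otimes> \<sigma> n a) (\<lambda>y. k (q y))"] ballI iter_wreath_SucI)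
      fix z assume "z \<in> tuples G (Suc n)"
      then show "diag_perm G (Suc n) \<sigma> (w z) =
          level_map G n (\<lambda>y. y \<otimes> \<sigma> n a) (\<lambda>y. k (q y)) (diag_perm G (Suc n) \<sigma> z)"
        using w k q' d hom_mult[OF hom]
        by (auto elim!: tuples_SucE simp: iter_wreath_in_tuples)
    qed (use w k q q' in auto)
  qed
  moreover have "\<exists>w\<in>iter_wreath G (Suc n). \<forall>z\<in>tuples G (Suc n).
      diag_perm G (Suc n) \<sigma> (w z) = w' (diag_perm G (Suc n) \<sigma> z)"
    if mem: "w' \<in> iter_wreath G (Suc n)" for w'
  proof -
    obtain a h where w: "a \<in> carrier G" "\<forall>y\<in>carrier G. h y \<in> iter_wreath G n"
      "w' = level_map G n (\<lambda>y. y \<otimes> a) h" using mem by (rule iter_wreath_SucE)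
    have "\<forall>y\<in>carrier G. \<exists>w\<in>iter_wreath G n. \<forall>x\<in>tuples G n. ?d (w x) = h y (?d x)"
      using IH w(2) by (simp add: normalizing_perm_def)
    then obtain k where k: "\<forall>y\<in>carrier G. k y \<in> iter_wreath G n \<and> (\<forall>x\<in>tuples G n. ?d (k y x) = h y (?d x))"
      by metis
    \<comment> \<open>Conversely, a point with head \<open>y\<close> is sent to head
      \<open>\<sigma> n y\<close>, where the component of \<open>w'\<close> has to be
      matched.\<close>
    show ?thesis
    proof (intro bexI[of _ "level_map G n (\<lambda>y. y \<otimes> q a) (\<lambda>y. k (\<sigma> n y))"] ballI iter_wreath_SucI)
      fix z assume "z \<in> tuples G (Suc n)"
      then show "diag_perm G (Suc n) \<sigma> (level_map G n (\<lambda>y. y \<otimes> q a) (\<lambda>y. k (\<sigma> n y)) z) =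
          w' (diag_perm G (Suc n) \<sigma> z)"
        using w k q q' d hom_mult[OF hom]
        by (auto elim!: tuples_SucE simp: iter_wreath_in_tuples)
    qed (use w k q q' in auto)
  qed
  ultimately show ?case
    using diag_perm_Bij[OF Suc.prems] by (simp add: normalizing_perm_def)
qed

text \<open>An automorphism fixes \<open>\<one>\<close>, so it can be a translation only if it is
  trivial. The component over \<open>\<one>\<close> then places the lower diagonal permutation in
  \<open>iter_wreath G n\<close>, and induction applies.\<close>

lemma diag_perm_iter_wreath:
  "\<sigma> \<in> {..<n} \<rightarrow> auto G \<Longrightarrow> diag_perm G n \<sigma> \<in> iter_wreath G n \<Longrightarrow>
    diag_perm G n \<sigma> = (\<lambda>z\<in>tuples G n. z)"
proof (induction n)
  case (Suc n)
  have "\<sigma> n \<in> auto G" using Suc.prems by auto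
  then have hom: "\<sigma> n \<in> hom G G" by (auto simp: auto_def)
  obtain a h where w: "a \<in> carrier G" "\<forall>y\<in>carrier G. h y \<in> iter_wreath G n"
    "diag_perm G (Suc n) \<sigma> = level_map G n (\<lambda>y. y \<otimes> a) h"
    using Suc.prems(2) by (rule iter_wreath_SucE)
  have eq: "\<sigma> n y = y \<otimes> a \<and> diag_perm G n \<sigma> x = h y x"
    if "y \<in> carrier G" "x \<in> tuples G n" for y x
    using that fun_cong[OF w(3), of "y # x"] by simp
  have "\<sigma> n \<one> = \<one>"
    using hom_one[OF hom is_group is_group] .
  then have "a = \<one>"
    using eq[OF one_closed tuples_nonempty] w(1) by simp
  moreover have "diag_perm G n \<sigma> \<in> extensional (tuples G n)"
    by (cases n) auto
  then have "diag_perm G n \<sigma> = h \<one>"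
    using w(2) eq iter_wreath_Bij[of n]
    by (intro extensionalityI[of _ "tuples G n"]) (auto intro!: Bij_imp_extensional)
  then have "diag_perm G n \<sigma> = (\<lambda>z\<in>tuples G n. z)"
    using Suc.prems(1) w(2) by (intro Suc.IH) auto
  ultimately show ?case
    using eq by (intro extensionalityI[of _ "tuples G (Suc n)"] restrict_extensional)
      (auto elim!: tuples_SucE)
qed simp

section \<open>Decomposition of normalizing permutations\<close>

lemma normalizing_perm_decomp:
  "normalizing_perm G n \<phi> \<Longrightarrow>
    \<exists>w\<in>iter_wreath G n. \<exists>\<sigma>\<in>{..<n} \<rightarrow> auto G. \<forall>z\<in>tuples G n. \<phi> z = w (diag_perm G n \<sigma> z)"
proof (induction n arbitrary: \<phi>)
  case 0
  then have "\<phi> [] = []"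
    using normalizing_perm_in_tuples[OF 0, of "[]"] by simp
  then show ?case by simp
next
  case (Suc n)
  note \<phi> = Suc.prems
  \<comment> \<open>An arbitrary tail: by \<open>normalizing_perm_hd\<close> the head of the image
    does not depend on it.\<close>
  define x0 where "x0 = replicate n \<one>"
  have x0: "x0 \<in> tuples G n" by (simp add: x0_def tuples_nonempty)
  define p where "p y = hd (\<phi> (y # x0))" for y
  define F where "F y = (\<lambda>x\<in>tuples G n. tl (\<phi> (y # x)))" for y
  have \<phi>_Cons: "\<phi> (y # x) = p y # F y x \<and> p y \<in> carrier G \<and> F y x \<in> tuples G n"
    if "y \<in> carrier G" "x \<in> tuples G n" for y x
  proof -
    have hd: "hd (\<phi> (y # x)) = p y"
      unfolding p_def using that x0 by (subst normalizing_perm_hd[OF \<phi>]) auto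
    have "\<phi> (y # x) \<in> tuples G (Suc n)"
      using that by (intro normalizing_perm_in_tuples[OF \<phi>]) simp
    then obtain u v where "\<phi> (y # x) = u # v" "u \<in> carrier G" "v \<in> tuples G n"
      by (rule tuples_SucE)
    with hd that show ?thesis by (simp add: F_def)
  qed
  have p_closed: "p y \<in> carrier G" if "y \<in> carrier G" for y
    using \<phi>_Cons[OF that x0] by simp
  have p_inj: "p y = p y' \<longleftrightarrow> y = y'" if "y \<in> carrier G" "y' \<in> carrier G" for y y'
    using that x0 normalizing_perm_hd[OF \<phi>, of "y # x0" "y' # x0"] by (simp add: p_def)
  have \<phi>_inj: "inj_on \<phi> (tuples G (Suc n))" and \<phi>_surj: "\<phi> ` tuples G (Suc n) = tuples G (Suc n)"
    using \<phi> by (auto simp: normalizing_perm_def Bij_def bij_betw_def)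
  have \<phi>_onto: "\<exists>y'\<in>carrier G. \<exists>x'\<in>tuples G n. p y' = y \<and> F y' x' = x"
    if yx: "y \<in> carrier G" "x \<in> tuples G n" for y x
  proof -
    have "y # x \<in> \<phi> ` tuples G (Suc n)" using yx \<phi>_surj by simp
    then obtain y' x' where "y # x = \<phi> (y' # x')" "y' \<in> carrier G" "x' \<in> tuples G n"
      by (auto elim: tuples_SucE)
    then show ?thesis using \<phi>_Cons by auto
  qed
  have "F \<one> \<in> Bij (tuples G n)"
  proof -
    have "inj_on (F \<one>) (tuples G n)"
    proof (rule inj_onI)
      fix x x' assume x: "x \<in> tuples G n" "x' \<in> tuples G n" "F \<one> x = F \<one> x'"
      then have "\<phi> (\<one> # x) = \<phi> (\<one> # x')" by (simp add: \<phi>_Cons)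
      then show "x = x'" using inj_onD[OF \<phi>_inj, of "\<one> # x" "\<one> # x'"] x by simp
    qed
    moreover have "x \<in> F \<one> ` tuples G n" if x: "x \<in> tuples G n" for x
    proof -
      \<comment> \<open>A preimage of a point over \<open>p \<one>\<close> must itself lie over
        \<open>\<one>\<close>, because \<open>p\<close> is injective.\<close>
      obtain y' x' where y': "y' \<in> carrier G" "x' \<in> tuples G n" "p y' = p \<one>" "F y' x' = x"
        using \<phi>_onto[OF p_closed[OF one_closed] x] by blast
      then have "y' = \<one>" using p_inj[OF _ one_closed] by blast
      with y' show ?thesis by blast
    qed
    moreover have "F \<one> ` tuples G n \<subseteq> tuples G n"
      using \<phi>_Cons[OF one_closed] by (intro image_subsetI) simp
    moreover have "F \<one> \<in> extensional (tuples G n)"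
      unfolding F_def by (rule restrict_extensional)
    ultimately show ?thesis
      unfolding Bij_def bij_betw_def by blast
  qed
  moreover have "\<exists>w'\<in>iter_wreath G n. \<forall>x\<in>tuples G n. F \<one> (w x) = w' (F \<one> x)"
    if w: "w \<in> iter_wreath G n" for w
  proof -
    \<comment> \<open>This element fixes all heads and acts by \<open>w\<close> in every fibre.
      Comparing in the fibre over \<open>\<one>\<close> gives the component of its conjugate over
      \<open>p \<one>\<close>.\<close>
    have "level_map G n (\<lambda>y. y \<otimes> \<one>) (\<lambda>_. w) \<in> iter_wreath G (Suc n)"
      using w by (intro iter_wreath_SucI) auto
    then obtain w' where w': "w' \<in> iter_wreath G (Suc n)"
      "\<forall>z\<in>tuples G (Suc n). \<phi> (level_map G n (\<lambda>y. y \<otimes> \<one>) (\<lambda>_. w) z) = w' (\<phi> z)"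
      using \<phi> unfolding normalizing_perm_def by blast
    obtain c h where h: "c \<in> carrier G" "\<forall>y\<in>carrier G. h y \<in> iter_wreath G n"
      "w' = level_map G n (\<lambda>y. y \<otimes> c) h" using w'(1) by (rule iter_wreath_SucE)
    have "F \<one> (w x) = h (p \<one>) (F \<one> x)" if "x \<in> tuples G n" for x
      using w'(2)[rule_format, of "\<one> # x"] that h w by (simp add: \<phi>_Cons iter_wreath_in_tuples)
    then show ?thesis using h(2) p_closed by blast
  qed
  moreover have "\<exists>w\<in>iter_wreath G n. \<forall>x\<in>tuples G n. F \<one> (w x) = w' (F \<one> x)"
    if w': "w' \<in> iter_wreath G n" for w'
  proof -
    have "level_map G n (\<lambda>y. y \<otimes> \<one>) (\<lambda>_. w') \<in> iter_wreath G (Suc n)"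
      using w' by (intro iter_wreath_SucI) auto
    then obtain w where w: "w \<in> iter_wreath G (Suc n)"
      "\<forall>z\<in>tuples G (Suc n). \<phi> (w z) = level_map G n (\<lambda>y. y \<otimes> \<one>) (\<lambda>_. w') (\<phi> z)"
      using \<phi> unfolding normalizing_perm_def by blast
    obtain c h where h: "c \<in> carrier G" "\<forall>y\<in>carrier G. h y \<in> iter_wreath G n"
      "w = level_map G n (\<lambda>y. y \<otimes> c) h" using w(1) by (rule iter_wreath_SucE)
    have eq: "p c = p \<one> \<and> F c (h \<one> x) = w' (F \<one> x)" if "x \<in> tuples G n" for x
      using w(2)[rule_format, of "\<one> # x"] that h by (simp add: \<phi>_Cons iter_wreath_in_tuples)
    \<comment> \<open>The relation for tails mentions \<open>F c\<close>; comparing heads brings it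
      back to \<open>F \<one>\<close>.\<close>
    then have "c = \<one>" using x0 p_inj[OF h(1) one_closed] by blast
    then show ?thesis using h(2) eq by blast
  qed
  ultimately have "normalizing_perm G n (F \<one>)"
    by (simp add: normalizing_perm_def)
  then obtain w1 \<sigma> where w1: "w1 \<in> iter_wreath G n" and \<sigma>: "\<sigma> \<in> {..<n} \<rightarrow> auto G"
    and F1: "\<And>x. x \<in> tuples G n \<Longrightarrow> F \<one> x = w1 (diag_perm G n \<sigma> x)"
    using Suc.IH by blast
  \<comment> \<open>The conjugate of the translation of heads by \<open>a\<close> has some
    translation part \<open>c\<close>. Heads give the law for \<open>p\<close>, and tails at head
    \<open>\<one>\<close> relate \<open>F a\<close> to \<open>F \<one>\<close>.\<close>
  have trans: "\<exists>c\<in>carrier G. (\<forall>y\<in>carrier G. p (y \<otimes> a) = p y \<otimes> c) \<and>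
      (\<exists>h\<in>iter_wreath G n. \<forall>x\<in>tuples G n. F a x = h (F \<one> x))"
    if a: "a \<in> carrier G" for a
  proof -
    let ?t = "level_map G n (\<lambda>y. y \<otimes> a) (\<lambda>_. \<lambda>x\<in>tuples G n. x)"
    have "?t \<in> iter_wreath G (Suc n)"
      using a id_iter_wreath by (intro iter_wreath_SucI Pi_I)
    then obtain w' where w': "w' \<in> iter_wreath G (Suc n)"
      "\<forall>z\<in>tuples G (Suc n). \<phi> (?t z) = w' (\<phi> z)"
      using \<phi> unfolding normalizing_perm_def by blast
    obtain c h where h: "c \<in> carrier G" "\<forall>y\<in>carrier G. h y \<in> iter_wreath G n"
      "w' = level_map G n (\<lambda>y. y \<otimes> c) h" using w'(1) by (rule iter_wreath_SucE)
    have eq: "p (y \<otimes> a) = p y \<otimes> c \<and> F (y \<otimes> a) x = h (p y) (F y x)"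
      if "y \<in> carrier G" "x \<in> tuples G n" for y x
      using w'(2)[rule_format, of "y # x"] that h a by (simp add: \<phi>_Cons)
    show ?thesis
      using eq[OF _ x0] eq[OF one_closed] h a p_closed
      by (intro bexI[of _ c] conjI bexI[of _ "h (p \<one>)"]) auto
  qed
  then have "\<forall>y\<in>carrier G. \<exists>h\<in>iter_wreath G n. \<forall>x\<in>tuples G n. F y x = h (F \<one> x)"
    by blast
  then obtain k where k: "\<forall>y\<in>carrier G. k y \<in> iter_wreath G n \<and> (\<forall>x\<in>tuples G n. F y x = k y (F \<one> x))"
    by metis
  have p_mult: "p (y \<otimes> a) = p y \<otimes> inv p \<one> \<otimes> p a" if y: "y \<in> carrier G" and a: "a \<in> carrier G" for y a
  proof -
    obtain c where c: "c \<in> carrier G" "\<forall>y\<in>carrier G. p (y \<otimes> a) = p y \<otimes> c"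
      using trans[OF a] by blast
    then have "p a = p \<one> \<otimes> c" using a one_closed l_one by metis
    then have "c = inv p \<one> \<otimes> p a"
      using c(1) p_closed by (simp add: m_assoc[symmetric])
    with c y a p_closed show ?thesis by (simp add: m_assoc)
  qed
  \<comment> \<open>\<open>p_mult\<close> says exactly that \<open>p\<close> becomes multiplicative
    once \<open>p \<one>\<close> is stripped off on the right. Restriction provides the
    extensionality required by \<open>auto G\<close>.\<close>
  define \<beta> where "\<beta> = (\<lambda>y\<in>carrier G. p y \<otimes> inv p \<one>)"
  have \<beta>_bij: "bij_betw \<beta> (carrier G) (carrier G)"
  proof -
    have "inj_on \<beta> (carrier G)"
      using p_inj p_closed by (auto simp: \<beta>_def inj_on_def)
    moreover have "y \<in> \<beta> ` carrier G" if y: "y \<in> carrier G" for y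
    proof -
      obtain y' where "y' \<in> carrier G" "p y' = y \<otimes> p \<one>"
        using \<phi>_onto[OF m_closed[OF y p_closed[OF one_closed]] x0] by blast
      then show ?thesis
        using y p_closed by (intro image_eqI[of _ _ y']) (auto simp: \<beta>_def m_assoc)
    qed
    ultimately show ?thesis
      using p_closed by (auto simp: bij_betw_def \<beta>_def)
  qed
  have \<beta>: "\<beta> \<in> auto G"
    using \<beta>_bij p_closed
    by (auto simp: auto_def Bij_def hom_def \<beta>_def p_mult m_assoc)
  define q where "q = inv_into (carrier G) \<beta>"
  have q: "q y \<in> carrier G" "q (\<beta> y) = y" "\<beta> y \<in> carrier G" if "y \<in> carrier G" for y
    using \<beta>_bij that by (auto simp: q_def bij_betw_inv_into_left
        intro: bij_betw_apply bij_betw_apply[OF bij_betw_inv_into])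
  \<comment> \<open>After the diagonal permutation the head is \<open>\<beta> y\<close>. Translation
    by \<open>p \<one>\<close> makes it \<open>p y\<close>, and \<open>q\<close> recovers
    \<open>y\<close>, so that \<open>w1\<close> and then \<open>k y\<close> take the tail to
    \<open>F \<one> x\<close> and on to \<open>F y x\<close>.\<close>
  let ?w = "level_map G n (\<lambda>y. y \<otimes> p \<one>) (\<lambda>y. compose (tuples G n) (k (q y)) w1)"
  have "?w \<in> iter_wreath G (Suc n)"
    using q k w1 p_closed by (intro iter_wreath_SucI) (auto intro: compose_iter_wreath)
  moreover have "\<sigma>(n := \<beta>) \<in> {..<Suc n} \<rightarrow> auto G"
    using \<sigma> \<beta> by (auto simp: less_Suc_eq)
  moreover have "\<phi> z = ?w (diag_perm G (Suc n) (\<sigma>(n := \<beta>)) z)" if mem: "z \<in> tuples G (Suc n)" for z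
  proof -
    obtain y x where z: "z = y # x" "y \<in> carrier G" "x \<in> tuples G n"
      using mem by (rule tuples_SucE)
    have d: "diag_perm G n \<sigma> x \<in> tuples G n"
      using normalizing_perm_in_tuples[OF diag_perm_normalizing[OF \<sigma>] z(3)] .
    have \<sigma>': "diag_perm G n (\<sigma>(n := \<beta>)) = diag_perm G n \<sigma>"
      by (rule diag_perm_cong) simp
    have "\<beta> y \<otimes> p \<one> = p y"
      using z(2) p_closed by (simp add: \<beta>_def m_assoc)
    then show ?thesis
      using z d q k by (simp add: \<sigma>' \<phi>_Cons compose_def F1)
  qed
  ultimately show ?case by blast
qed

end

section \<open>The semidirect product decomposition\<close>

theorem mainTheorem1:
  fixes G :: "('a, 'b) monoid_scheme" and n :: nat
  assumes "group G"
  defines "S \<equiv> sym_grp (tuples G n)"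
    and "W \<equiv> iter_wreath G n"
  shows "\<exists>M. subgroup M S \<and>
             W \<lhd> S\<lparr>carrier := normalizer S W\<rparr> \<and>
             M <#>\<^bsub>S\<^esub> W = normalizer S W \<and>
             M \<inter> W = {\<one>\<^bsub>S\<^esub>} \<and>
             S\<lparr>carrier := M\<rparr> \<cong> product_group {..<n} (\<lambda>_. AutoGroup G)"
proof -
  interpret G: group G by fact
  interpret S: group S unfolding S_def by (rule group_sym_grp)
  define P where "P = product_group {..<n} (\<lambda>_. AutoGroup G)"
  have group_P: "group P"
    unfolding P_def using G.AutoGroup by simp
  have carrier_P: "carrier P = {..<n} \<rightarrow>\<^sub>E auto G"
    by (simp add: P_def AutoGroup_def)
  have Bij: "diag_perm G n \<sigma> \<in> carrier S" if "\<sigma> \<in> carrier P" for \<sigma>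
    using that G.diag_perm_Bij by (auto simp: S_def carrier_P)
  have mult: "diag_perm G n (\<sigma> \<otimes>\<^bsub>P\<^esub> \<tau>) = diag_perm G n \<tau> \<otimes>\<^bsub>S\<^esub> diag_perm G n \<sigma>"
    if \<sigma>: "\<sigma> \<in> carrier P" and \<tau>: "\<tau> \<in> carrier P" for \<sigma> \<tau>
  proof -
    have "(\<sigma> \<otimes>\<^bsub>P\<^esub> \<tau>) i = compose (carrier G) (\<sigma> i) (\<tau> i)" if "i < n" for i
    proof -
      have "\<sigma> i \<in> Bij (carrier G)" "\<tau> i \<in> Bij (carrier G)"
        using \<sigma> \<tau> that by (auto simp: carrier_P auto_def)
      with that show ?thesis
        by (simp add: P_def AutoGroup_def BijGroup_def)
    qed
    then have "diag_perm G n (\<sigma> \<otimes>\<^bsub>P\<^esub> \<tau>) = diag_perm G n (\<lambda>i. compose (carrier G) (\<sigma> i) (\<tau> i))"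
      by (intro diag_perm_cong) simp
    also have "\<dots> = compose (tuples G n) (diag_perm G n \<sigma>) (diag_perm G n \<tau>)"
      using \<sigma> \<tau> by (intro G.diag_perm_compose) (auto simp: carrier_P)
    finally show ?thesis
      using Bij[OF \<sigma>] Bij[OF \<tau>] by (simp add: S_def)
  qed
  \<comment> \<open>The product of \<open>AutoGroup G\<close> is ordinary composition, opposite to that of \<open>S\<close>,
    so \<open>diag_perm\<close> is an antihomomorphism; inversion corrects this.\<close>
  define E where "E \<sigma> = inv\<^bsub>S\<^esub> (diag_perm G n \<sigma>)" for \<sigma>
  have hom: "E \<in> hom P S"
    by (intro homI) (auto simp: E_def Bij mult S.inv_mult_group)
  have inj: "inj_on E (carrier P)"
  proof (rule inj_onI)
    fix \<sigma> \<tau> assume \<sigma>\<tau>: "\<sigma> \<in> carrier P" "\<tau> \<in> carrier P" "E \<sigma> = E \<tau>"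
    then have eq: "diag_perm G n \<sigma> = diag_perm G n \<tau>"
      using Bij by (metis E_def S.inv_inv)
    have auto: "\<sigma> i \<in> auto G" "\<tau> i \<in> auto G" if "i < n" for i
      using \<sigma>\<tau>(1,2) that by (auto simp: carrier_P)
    have "\<sigma> i = \<tau> i" if "i < n" for i
      using auto[OF that] G.diag_perm_eqD[OF eq that]
      by (intro extensionalityI[of _ "carrier G"]) (simp_all add: auto_def Bij_def)
    then show "\<sigma> = \<tau>"
      using \<sigma>\<tau>(1,2) unfolding carrier_P by (meson PiE_ext lessThan_iff)
  qed
  define M where "M = E ` carrier P"
  interpret E: group_hom P S E
    using hom group_P by (simp add: group_hom_def group_hom_axioms_def S.is_group)
  have M: "subgroup M S"
    unfolding M_def by (rule E.img_is_subgroup)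
  have W: "subgroup W S"
    unfolding W_def S_def by (rule G.subgroup_iter_wreath)
  have N: "subgroup (normalizer S W) S"
    by (intro S.normalizer_imp_subgroup subgroup.subset W)
  have normal: "W \<lhd> S\<lparr>carrier := normalizer S W\<rparr>"
    by (rule S.subgroup_in_normalizer[OF W])
  have W_N: "W \<subseteq> normalizer S W"
    using normal_imp_subgroup[OF normal] subgroup.subset by fastforce
  have M_N: "M \<subseteq> normalizer S W"
  proof
    fix f assume "f \<in> M"
    then obtain \<sigma> where \<sigma>: "\<sigma> \<in> carrier P" "f = inv\<^bsub>S\<^esub> (diag_perm G n \<sigma>)"
      by (auto simp: M_def E_def)
    have "diag_perm G n \<sigma> \<in> normalizer S W"
      unfolding S_def W_def G.mem_normalizer_iter_wreath
      using \<sigma>(1) by (intro G.diag_perm_normalizing) (auto simp: carrier_P)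
    with \<sigma>(2) show "f \<in> normalizer S W"
      using subgroup.m_inv_closed[OF N] by simp
  qed
  have "M <#>\<^bsub>S\<^esub> W = normalizer S W"
  proof (intro equalityI subsetI)
    fix f assume "f \<in> M <#>\<^bsub>S\<^esub> W"
    then show "f \<in> normalizer S W"
      using M_N W_N subgroup.m_closed[OF N] by (auto simp: set_mult_def)
  next
    fix f assume f: "f \<in> normalizer S W"
    then have f': "normalizing_perm G n f"
      by (simp add: S_def W_def G.mem_normalizer_iter_wreath)
    from G.normalizing_perm_decomp[OF f'] obtain w \<sigma> where w: "w \<in> W"
      and \<sigma>: "\<sigma> \<in> {..<n} \<rightarrow> auto G" and fw: "\<forall>z\<in>tuples G n. f z = w (diag_perm G n \<sigma> z)"
      unfolding W_def by blast
    \<comment> \<open>Elements of the product group are extensional on the index set, so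
      \<open>\<sigma>\<close> is cut down; the diagonal permutation stays the same.\<close>
    have \<sigma>': "restrict \<sigma> {..<n} \<in> carrier P"
      using \<sigma> by (auto simp: carrier_P)
    have eq: "diag_perm G n (restrict \<sigma> {..<n}) = diag_perm G n \<sigma>"
      by (rule diag_perm_cong) simp
    \<comment> \<open>\<open>E\<close> contains an inversion, which is undone inside the subgroup
      \<open>M\<close>.\<close>
    have "inv\<^bsub>S\<^esub> (E (restrict \<sigma> {..<n})) \<in> M"
      using \<sigma>' subgroup.m_inv_closed[OF M] by (simp add: M_def)
    then have d: "diag_perm G n \<sigma> \<in> M"
      using Bij[OF \<sigma>'] by (simp add: E_def eq)
    have "f \<in> extensional (tuples G n)"
      using f' by (simp add: normalizing_perm_def Bij_imp_extensional)
    then have "f = compose (tuples G n) w (diag_perm G n \<sigma>)"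
      using fw by (intro extensionalityI[of _ "tuples G n"]) (auto simp: compose_def)
    \<comment> \<open>Applying \<open>w\<close> last puts it on the right of the product in
      \<open>S\<close>.\<close>
    also have "\<dots> = diag_perm G n \<sigma> \<otimes>\<^bsub>S\<^esub> w"
      using subgroup.mem_carrier[OF M d] subgroup.mem_carrier[OF W w] by (simp add: S_def)
    finally show "f \<in> M <#>\<^bsub>S\<^esub> W"
      using d w by (auto simp: set_mult_def)
  qed
  moreover have "M \<inter> W = {\<one>\<^bsub>S\<^esub>}"
  proof (intro equalityI subsetI)
    fix f assume f: "f \<in> M \<inter> W"
    then obtain \<sigma> where \<sigma>: "\<sigma> \<in> carrier P" "f = inv\<^bsub>S\<^esub> (diag_perm G n \<sigma>)"
      by (auto simp: M_def E_def)
    then have "diag_perm G n \<sigma> \<in> W"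
      using f subgroup.m_inv_closed[OF W, of f] Bij by simp
    then have "diag_perm G n \<sigma> = \<one>\<^bsub>S\<^esub>"
      using \<sigma>(1) G.diag_perm_iter_wreath[of \<sigma> n] by (auto simp: carrier_P S_def W_def)
    with \<sigma>(2) show "f \<in> {\<one>\<^bsub>S\<^esub>}" by simp
  qed (use subgroup.one_closed[OF M] subgroup.one_closed[OF W] in auto)
  moreover have "S\<lparr>carrier := M\<rparr> \<cong> P"
  proof -
    have "E \<in> iso P (S\<lparr>carrier := M\<rparr>)"
      using hom inj by (auto simp: iso_def hom_def bij_betw_def M_def)
    then show ?thesis
      using group.iso_sym[OF group_P] is_isoI by blast
  qed
  ultimately show ?thesis
    using M normal unfolding P_def by blast
qed

end
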